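(* Let $\mathbf H$ be the infinite-dimensional real separable Hilbert space, let $F=\mathcal L(\xi)$ be the distribution of a random vector $\xi$ with values in $\mathbf H$, let $m\in\mathbf N$ and $t_1,\dots,t_m\in\mathbf H$, and suppose that for each $j=1,\dots,m$ the distribution of the real random variable $\langle\xi,t_j\rangle$ is either non-degenerate or equal to the distribution $E$ on $\mathbf R$ concentrated at $0$. Then there exists a constant $c(F,t_1,\dots,t_m)>0$, depending only on $F,t_1,\dots,t_m$, such that for all $n\in\mathbf N$ and all $P\in\mathcal P(t_1,\dots,t_m)$, $$\big|(F^n)\{P\}-(F^{n+1})\{P\}\big|\le c(F,t_1,\dots,t_m)\,n^{-1/2}.$$
   Context: $\mathbf H$ (also written $\mathbf R^\infty$, the case $d=\infty$) is the infinite-dimensional real separable Hilbert space with inner product $\langle\cdot,\cdot\rangle$. $\mathcal L(\xi)$ denotes the distribution of $\xi$. A distribution on $\mathbf R$ is non-degenerate if it is not concentrated at a single point. Powers of measures are convolution powers: $F^n=F^{n*}$. For $t_1,\dots,t_m\in\mathbf H$, $\mathcal P(t_1,\dots,t_m)$ is the collection of all sets of the form $P=\{x\in\mathbf H:\langle x,t_j\rangle\le b_j,\ j=1,\dots,m\}$ with $-\infty<b_j\le\infty$, $j=1,\dots,m$. *)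

theory Defs
  imports "HOL-Probability.Probability"
begin

(* Together with the sort {real_inner, polish_space} (complete and second countable, hence
   separable) this says that the type is an infinite-dimensional real separable Hilbert space. *)
definition infinite_dimensional :: "'a::real_vector itself \<Rightarrow> bool" where
  "infinite_dimensional (_ :: 'a itself) \<longleftrightarrow> \<not> (\<exists>B :: 'a set. finite B \<and> span B = UNIV)"

(* The convolution of HOL-Probability is only available on ordered Euclidean spaces; this is the
   same definition on a larger class of types. *)
definition conv :: "'a::{real_normed_vector, second_countable_topology} measure \<Rightarrow> 'a measure \<Rightarrow> 'a measure" where
  "conv M N = distr (M \<Otimes>\<^sub>M N) borel (\<lambda>(x, y). x + y)"

primrec conv_power :: "'a::{real_normed_vector, second_countable_topology} measure \<Rightarrow> nat \<Rightarrow> 'a measure" where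
  "conv_power F 0 = return borel 0"
| "conv_power F (Suc n) = conv F (conv_power F n)"

definition nondegenerate :: "real measure \<Rightarrow> bool" where
  "nondegenerate D \<longleftrightarrow> \<not> (\<exists>a. AE x in D. x = a)"

(* The vectors t_1, ..., t_m are the values of t on {1..m}. *)
definition polyhedra :: "nat \<Rightarrow> (nat \<Rightarrow> 'a::real_inner) \<Rightarrow> 'a set set" where
  "polyhedra m t = {P. \<exists>b :: nat \<Rightarrow> ereal. (\<forall>j\<in>{1..m}. - \<infinity> < b j) \<and>
     P = {x. \<forall>j\<in>{1..m}. ereal (inner x (t j)) \<le> b j}}"

end

theory Submission
  imports Defs
begin

text \<open>
  Since \<open>S\<^sub>n\<close> and \<open>S\<^sub>n + \<xi>\<close> are separated by the polyhedron only if some \<open>\<langle>S\<^sub>n, t\<^sub>j\<rangle>\<close> lies within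
  \<open>\<bar>\<langle>\<xi>, t\<^sub>j\<rangle>\<bar>\<close> of \<open>b\<^sub>j\<close>, a concentration bound of order \<open>n\<^sup>-\<^sup>1\<^sup>/\<^sup>2\<close> settles the case of a bounded \<open>\<xi>\<close>.
  In general write \<open>F = (1 - p) U + p V\<close> with \<open>U\<close> the law \<open>F\<close> conditioned on a large ball. Then \<open>F\<^sup>n\<close> is the
  mixture of the measures \<open>U\<^sup>n\<^sup>-\<^sup>k * V\<^sup>k\<close> with binomial weights in \<open>k\<close>. The binomial laws with \<open>n\<close> and \<open>n + 1\<close> trials
  differ by \<open>O(n\<^sup>-\<^sup>1\<^sup>/\<^sup>2)\<close> in total variation, so \<open>k\<close> may be kept fixed, and only the number of bounded
  factors changes by one. Concentration of \<open>U\<^sup>k\<close> comes from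
  Esseen's inequality and \<open>\<bar>char D s\<bar> \<le> 1 - w s\<^sup>2\<close> near \<open>0\<close> for a non-degenerate bounded law \<open>D\<close>.
\<close>

subsection \<open>Convolution of Borel probability measures\<close>

text \<open>\<open>conv\<close> always returns a measure on the Borel sets, so laws such as
  \<open>conv M (return borel 0) = M\<close> can hold only for measures that live there.\<close>

definition borel_prob :: "'a::topological_space measure \<Rightarrow> bool" where
  "borel_prob M \<longleftrightarrow> prob_space M \<and> sets M = sets borel"

lemma borel_probD:
  assumes "borel_prob M"
  shows "prob_space M" "sets M = sets borel" "space M = UNIV"
  using assms sets_eq_imp_space_eq[of M borel] by (auto simp: borel_prob_def)

lemma measurable_plus_pair:
  fixes M N :: "'a::{real_normed_vector, second_countable_topology} measure"
  assumes "sets M = sets borel" "sets N = sets borel"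
  shows "(\<lambda>(x, y). x + y) \<in> M \<Otimes>\<^sub>M N \<rightarrow>\<^sub>M borel"
proof -
  have "sets (M \<Otimes>\<^sub>M N) = sets (borel \<Otimes>\<^sub>M borel)"
    using assms by (rule sets_pair_measure_cong)
  then show ?thesis
    by (simp cong: measurable_cong_sets)
qed

lemma borel_prob_conv:
  assumes "borel_prob M" "borel_prob N"
  shows "borel_prob (conv M N)"
proof -
  note M = borel_probD[OF assms(1)] and N = borel_probD[OF assms(2)]
  interpret M: prob_space M by (rule M)
  interpret N: prob_space N by (rule N)
  interpret pair_prob_space M N ..
  show ?thesis
    unfolding borel_prob_def conv_def
    using prob_space_distr[OF measurable_plus_pair[OF M(2) N(2)]] by simp
qed

lemma borel_prob_return: "borel_prob (return borel x)"
  by (auto simp: borel_prob_def intro!: prob_space_return)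

lemma borel_prob_conv_power: "borel_prob F \<Longrightarrow> borel_prob (conv_power F n)"
  by (induction n) (auto intro: borel_prob_conv borel_prob_return)

lemma integral_conv:
  fixes M N :: "'a::{real_normed_vector, second_countable_topology} measure"
    and f :: "'a \<Rightarrow> 'b::{banach, second_countable_topology}"
  assumes "borel_prob M" "borel_prob N" and f: "f \<in> borel_measurable borel" "\<And>x. norm (f x) \<le> B"
  shows "integral\<^sup>L (conv M N) f = (\<integral>x. \<integral>y. f (x + y) \<partial>N \<partial>M)"
proof -
  note M = borel_probD[OF assms(1)] and N = borel_probD[OF assms(2)]
  interpret M: prob_space M by (rule M)
  interpret N: prob_space N by (rule N)
  interpret P: pair_prob_space M N ..
  note meas = measurable_plus_pair[OF M(2) N(2)]
  have f': "(\<lambda>(x, y). f (x + y)) \<in> borel_measurable (M \<Otimes>\<^sub>M N)"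
    using measurable_compose[OF meas f(1)] by (simp add: case_prod_unfold)
  have int: "integrable (M \<Otimes>\<^sub>M N) (\<lambda>(x, y). f (x + y))"
    by (rule P.integrable_const_bound[OF _ f', where B = B]) (use f(2) in auto)
  have "integral\<^sup>L (conv M N) f = (\<integral>z. f (case z of (x, y) \<Rightarrow> x + y) \<partial>(M \<Otimes>\<^sub>M N))"
    unfolding conv_def by (rule integral_distr[OF meas f(1)])
  also have "\<dots> = (\<integral>z. (case z of (x, y) \<Rightarrow> f (x + y)) \<partial>(M \<Otimes>\<^sub>M N))"
    by (simp add: case_prod_unfold)
  also have "\<dots> = (\<integral>x. \<integral>y. f (x + y) \<partial>N \<partial>M)"
    by (rule P.integral_fst[OF int, symmetric])
  finally show ?thesis .
qed

text \<open>The version for nonnegative functions carries no integrability conditions, so iterated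
  integrals of indicators can be regrouped freely in the proof of associativity.\<close>

lemma nn_integral_conv:
  fixes M N :: "'a::{real_normed_vector, second_countable_topology} measure"
  assumes "borel_prob M" "borel_prob N" and f: "f \<in> borel_measurable borel"
  shows "(\<integral>\<^sup>+x. f x \<partial>conv M N) = (\<integral>\<^sup>+x. \<integral>\<^sup>+y. f (x + y) \<partial>N \<partial>M)"
proof -
  note M = borel_probD[OF assms(1)] and N = borel_probD[OF assms(2)]
  interpret M: prob_space M by (rule M)
  interpret N: prob_space N by (rule N)
  note meas = measurable_plus_pair[OF M(2) N(2)]
  have f': "(\<lambda>z. f (case z of (x, y) \<Rightarrow> x + y)) \<in> borel_measurable (M \<Otimes>\<^sub>M N)"
    using measurable_compose[OF meas f] .
  show ?thesis
    unfolding conv_def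
    using N.nn_integral_fst[OF f'] by (simp add: nn_integral_distr[OF meas] f)
qed

lemma conv_commute:
  fixes M N :: "'a::{real_normed_vector, second_countable_topology} measure"
  assumes "borel_prob M" "borel_prob N"
  shows "conv M N = conv N M"
proof -
  note M = borel_probD[OF assms(1)] and N = borel_probD[OF assms(2)]
  interpret M: prob_space M by (rule M)
  interpret N: prob_space N by (rule N)
  interpret P: pair_prob_space M N ..
  have "conv M N = distr (distr (N \<Otimes>\<^sub>M M) (M \<Otimes>\<^sub>M N) (\<lambda>(x, y). (y, x))) borel (\<lambda>(x, y). x + y)"
    unfolding conv_def by (subst P.distr_pair_swap) simp
  also have "\<dots> = conv N M"
    unfolding conv_def
    by (subst distr_distr[OF measurable_plus_pair[OF M(2) N(2)] measurable_pair_swap'])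
       (simp add: comp_def case_prod_unfold add.commute)
  finally show ?thesis .
qed

lemma conv_assoc:
  fixes L M N :: "'a::{real_normed_vector, second_countable_topology} measure"
  assumes L: "borel_prob L" and M: "borel_prob M" and N: "borel_prob N"
  shows "conv (conv L M) N = conv L (conv M N)"
proof (rule measure_eqI)
  show "sets (conv (conv L M) N) = sets (conv L (conv M N))"
    by (simp add: conv_def)
next
  fix A assume "A \<in> sets (conv (conv L M) N)"
  then have A [measurable]: "A \<in> sets borel"
    by (simp add: conv_def)
  interpret N: prob_space N
    using N by (rule borel_probD)
  note [measurable_cong] = borel_probD(2)[OF L] borel_probD(2)[OF M] borel_probD(2)[OF N]
  have [measurable]: "(indicator A :: 'a \<Rightarrow> ennreal) \<in> borel_measurable borel"
    by measurable
  have "emeasure (conv (conv L M) N) A = (\<integral>\<^sup>+x. indicator A x \<partial>conv (conv L M) N)"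
    using A by (simp add: conv_def)
  also have "\<dots> = (\<integral>\<^sup>+x. \<integral>\<^sup>+y. indicator A (x + y) \<partial>N \<partial>conv L M)"
    by (subst nn_integral_conv) (auto intro: borel_prob_conv assms)
  also have "\<dots> = (\<integral>\<^sup>+x. \<integral>\<^sup>+y. \<integral>\<^sup>+z. indicator A (x + y + z) \<partial>N \<partial>M \<partial>L)"
    by (subst nn_integral_conv) (auto intro: assms)
  also have "\<dots> = (\<integral>\<^sup>+x. \<integral>\<^sup>+y. indicator A (x + y) \<partial>conv M N \<partial>L)"
    by (subst nn_integral_conv) (auto intro: assms simp: add.assoc)
  also have "\<dots> = (\<integral>\<^sup>+x. indicator A x \<partial>conv L (conv M N))"
    by (subst nn_integral_conv) (auto intro: borel_prob_conv assms)
  also have "\<dots> = emeasure (conv L (conv M N)) A"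
    using A by (simp add: conv_def)
  finally show "emeasure (conv (conv L M) N) A = emeasure (conv L (conv M N)) A" .
qed

lemma conv_left_commute:
  fixes L M N :: "'a::{real_normed_vector, second_countable_topology} measure"
  assumes "borel_prob L" "borel_prob M" "borel_prob N"
  shows "conv L (conv M N) = conv M (conv L N)"
  by (metis assms conv_assoc conv_commute)

lemma conv_return_0:
  fixes M :: "'a::{real_normed_vector, second_countable_topology} measure"
  assumes "borel_prob M"
  shows "conv M (return borel 0) = M"
proof (rule measure_eqI)
  show "sets (conv M (return borel 0)) = sets M"
    using borel_probD(2)[OF assms] by (simp add: conv_def)
next
  fix A assume "A \<in> sets (conv M (return borel 0))"
  then have A [measurable]: "A \<in> sets borel"
    by (simp add: conv_def)
  have "emeasure (conv M (return borel 0)) A = (\<integral>\<^sup>+x. indicator A x \<partial>conv M (return borel 0))"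
    using A by (simp add: conv_def)
  also have "\<dots> = (\<integral>\<^sup>+x. \<integral>\<^sup>+y. indicator A (x + y) \<partial>return borel 0 \<partial>M)"
    by (subst nn_integral_conv) (auto intro: assms borel_prob_return)
  also have "\<dots> = (\<integral>\<^sup>+x. indicator A x \<partial>M)"
    by (subst nn_integral_return) auto
  also have "\<dots> = emeasure M A"
    using A borel_probD(2)[OF assms] by simp
  finally show "emeasure (conv M (return borel 0)) A = emeasure M A" .
qed

lemma measure_conv:
  fixes M N :: "'a::{real_normed_vector, second_countable_topology} measure"
  assumes "borel_prob M" "borel_prob N" and A: "A \<in> sets borel"
  shows "measure (conv M N) A = (\<integral>x. \<integral>y. indicator A (x + y) \<partial>N \<partial>M)"
proof -
  have "measure (conv M N) A = (\<integral>x. indicator A x \<partial>conv M N)"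
    using A by (simp add: conv_def)
  also have "\<dots> = (\<integral>x. \<integral>y. indicator A (x + y) \<partial>N \<partial>M)"
    by (rule integral_conv[where B = 1]) (use assms in \<open>auto simp: indicator_def\<close>)
  finally show ?thesis .
qed

subsection \<open>Binomial weights\<close>

text \<open>Pascal's rule, from conditioning on one trial. At \<open>k = n\<close> the last term
  vanishes because \<open>n choose Suc n\<close> is 0.\<close>

lemma Bernstein_Suc_Suc:
  "k \<le> n \<Longrightarrow> Bernstein (Suc n) (Suc k) p = p * Bernstein n k p + (1 - p) * Bernstein n (Suc k) p"
proof (cases "k = n")
  case False
  assume "k \<le> n"
  then have "n - k = Suc (n - Suc k)" using False by simp
  then show ?thesis by (simp add: Bernstein_def algebra_simps)
qed (simp add: Bernstein_def)

text \<open>The mean of \<open>f\<close> over \<open>Suc n\<close> trials, with one trial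
  conditioned on. This is the induction step for expanding a power of a mixture.\<close>

lemma sum_Bernstein_Suc:
  "(\<Sum>k\<le>Suc n. Bernstein (Suc n) k p * f k) = (\<Sum>k\<le>n. Bernstein n k p * ((1 - p) * f k + p * f (Suc k)))"
proof -
  have "(\<Sum>k\<le>Suc n. Bernstein (Suc n) k p * f k) =
      (1 - p) * (Bernstein n 0 p * f 0) + (\<Sum>k\<le>n. Bernstein (Suc n) (Suc k) p * f (Suc k))"
    by (subst sum.atMost_Suc_shift) (simp add: Bernstein_def)
  also have "(\<Sum>k\<le>n. Bernstein (Suc n) (Suc k) p * f (Suc k)) =
      (\<Sum>k\<le>n. Bernstein n k p * (p * f (Suc k))) + (1 - p) * (\<Sum>k\<le>n. Bernstein n (Suc k) p * f (Suc k))"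
    by (simp add: Bernstein_Suc_Suc sum_distrib_left algebra_simps flip: sum.distrib)
  also have "(1 - p) * (Bernstein n 0 p * f 0) + \<dots> =
      (1 - p) * (\<Sum>k\<le>Suc n. Bernstein n k p * f k) + (\<Sum>k\<le>n. Bernstein n k p * (p * f (Suc k)))"
    by (subst sum.atMost_Suc_shift) (simp add: algebra_simps)
  also have "(\<Sum>k\<le>Suc n. Bernstein n k p * f k) = (\<Sum>k\<le>n. Bernstein n k p * f k)"
    by (simp add: Bernstein_def)
  finally have eq: "(\<Sum>k\<le>Suc n. Bernstein (Suc n) k p * f k) =
      (1 - p) * (\<Sum>k\<le>n. Bernstein n k p * f k) + (\<Sum>k\<le>n. Bernstein n k p * (p * f (Suc k)))" .
  show ?thesis
    unfolding eq by (simp add: sum_distrib_left algebra_simps flip: sum.distrib)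
qed

text \<open>The ratio of the two binomial weights is linear in \<open>k\<close>. Both the inverse
  moment and the total variation estimate below rest on this. The factor on the left is a real
  difference, so that \<open>k = Suc n\<close> gives 0 on both sides.\<close>

lemma Bernstein_Suc_absorb:
  assumes "k \<le> Suc n"
  shows "(real n + 1 - real k) * Bernstein (Suc n) k p = (real n + 1) * (1 - p) * Bernstein n k p"
proof (cases "k = Suc n")
  case False
  with assms have k: "k \<le> n" by simp
  have "real ((Suc n - k) * (Suc n choose k)) = real (Suc n * (n choose k))"
    using binomial_absorb_comp[of "Suc n" k] by (simp only: diff_Suc_1)
  moreover have "real (Suc n - k) = real n + 1 - real k" "real (Suc n) = real n + 1"
    using k by (auto simp: of_nat_diff)
  ultimately have "(real n + 1 - real k) * real (Suc n choose k) = (real n + 1) * real (n choose k)"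
    by (simp only: of_nat_mult)
  then show ?thesis
    using k by (simp add: Bernstein_def Suc_diff_le)
qed (simp add: Bernstein_def)

lemma sum_Bernstein_variance:
  "(\<Sum>k\<le>n. Bernstein n k p * (real k - real n * p)\<^sup>2) = real n * p * (1 - p)"
proof -
  have "(\<Sum>k\<le>n. Bernstein n k p * (real k - real n * p)\<^sup>2) =
      (\<Sum>k\<le>n. real k * (real k - 1) * Bernstein n k p) + (1 - 2 * real n * p) * (\<Sum>k\<le>n. real k * Bernstein n k p)
      + (real n * p)\<^sup>2 * (\<Sum>k\<le>n. Bernstein n k p)"
    unfolding sum_distrib_left sum.distrib[symmetric]
    by (intro sum.cong refl) (simp add: power2_eq_square algebra_simps)
  also have "\<dots> = real n * p * (1 - p)"
    by (simp only: sum_kk_Bernstein sum_k_Bernstein sum_Bernstein) (simp add: power2_eq_square algebra_simps)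
  finally show ?thesis .
qed

text \<open>The arithmetic-geometric mean inequality. With \<open>c\<close> set to the expected size
  of \<open>x\<close>, it does the work of Cauchy-Schwarz when a first moment is bounded by a second
  one.\<close>

lemma abs_le_half_weighted_square:
  fixes x c :: real
  assumes "c > 0"
  shows "\<bar>x\<bar> \<le> (x\<^sup>2 / c + c) / 2"
proof -
  have "0 \<le> (\<bar>x\<bar> - c)\<^sup>2" by simp
  then have "2 * \<bar>x\<bar> * c \<le> x\<^sup>2 + c\<^sup>2"
    by (simp add: power2_diff)
  then show ?thesis
    using assms by (simp add: field_simps power2_eq_square)
qed

text \<open>In the expansion of a mixture \<open>n - k\<close> counts the factors \<open>U\<close>,
  so this averages the error of one bounded step. Absorption bounds the mean of
  \<open>1 / (n - k + 1)\<close>, and the preceding inequality with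
  \<open>c = 1 / sqrt (n + 1)\<close> passes to the square root.\<close>

lemma sum_Bernstein_inverse_sqrt_le:
  assumes p: "0 \<le> p" "p < 1"
  shows "(\<Sum>k\<le>n. Bernstein n k p * (1 / sqrt (real (n - k) + 1))) \<le> 1 / ((1 - p) * sqrt (real n + 1))"
proof -
  let ?N = "real n + 1"
  have "(\<Sum>k\<le>n. Bernstein n k p * (1 / (real (n - k) + 1))) = (\<Sum>k\<le>n. Bernstein (Suc n) k p / (?N * (1 - p)))"
  proof (intro sum.cong refl)
    fix k assume "k \<in> {..n}"
    then have "(real (n - k) + 1) * Bernstein (Suc n) k p = ?N * (1 - p) * Bernstein n k p"
      using Bernstein_Suc_absorb[of k n p] by (simp add: of_nat_diff algebra_simps)
    moreover have "real (n - k) + 1 \<noteq> 0" "?N * (1 - p) \<noteq> 0"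
      using p by (auto simp: add_nonneg_eq_0_iff)
    ultimately have "Bernstein n k p / (real (n - k) + 1) = Bernstein (Suc n) k p / (?N * (1 - p))"
      by (subst frac_eq_eq) (simp_all only: mult.commute not_False_eq_True)
    then show "Bernstein n k p * (1 / (real (n - k) + 1)) = Bernstein (Suc n) k p / (?N * (1 - p))"
      by simp
  qed
  \<comment> \<open>The nonnegative term \<open>k = Suc n\<close> is added to complete the total
    mass 1.\<close>
  also have "\<dots> \<le> (\<Sum>k\<le>Suc n. Bernstein (Suc n) k p) / (?N * (1 - p))"
    using p Bernstein_nonneg[of p "Suc n" "Suc n"] by (simp add: sum_divide_distrib[symmetric] divide_right_mono del: sum_Bernstein)
  also have "\<dots> = 1 / (?N * (1 - p))"
    by (simp only: sum_Bernstein)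
  finally have inv: "(\<Sum>k\<le>n. Bernstein n k p * (1 / (real (n - k) + 1))) \<le> 1 / (?N * (1 - p))" .
  have "(\<Sum>k\<le>n. Bernstein n k p * (1 / sqrt (real (n - k) + 1))) \<le>
      (\<Sum>k\<le>n. Bernstein n k p * (((1 / (real (n - k) + 1)) * sqrt ?N + 1 / sqrt ?N) / 2))"
  proof (intro sum_mono mult_left_mono)
    fix k
    show "1 / sqrt (real (n - k) + 1) \<le> ((1 / (real (n - k) + 1)) * sqrt ?N + 1 / sqrt ?N) / 2"
      using abs_le_half_weighted_square[of "1 / sqrt ?N" "1 / sqrt (real (n - k) + 1)"] by (simp add: power_divide)
  qed (use p in \<open>simp add: Bernstein_nonneg\<close>)
  also have "\<dots> = ((\<Sum>k\<le>n. Bernstein n k p * (1 / (real (n - k) + 1))) * sqrt ?N + (\<Sum>k\<le>n. Bernstein n k p) * (1 / sqrt ?N)) / 2"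
    unfolding sum_distrib_right sum.distrib[symmetric] sum_divide_distrib
    by (intro sum.cong refl) (simp add: algebra_simps add_divide_distrib)
  also have "\<dots> \<le> (1 / (?N * (1 - p)) * sqrt ?N + 1 / ((1 - p) * sqrt ?N)) / 2"
  proof -
    have "1 / sqrt ?N \<le> 1 / ((1 - p) * sqrt ?N)"
      using p by (intro divide_left_mono mult_pos_pos) (auto intro: mult_left_le_one_le)
    then show ?thesis
      unfolding sum_Bernstein mult_1_left by (intro divide_right_mono add_mono mult_right_mono inv) simp_all
  qed
  also have "1 / (?N * (1 - p)) * sqrt ?N = sqrt ?N / ?N / (1 - p)"
    by simp
  also have "\<dots> = 1 / ((1 - p) * sqrt ?N)"
    by (simp add: sqrt_divide_self_eq inverse_eq_divide)
  finally show ?thesis by simp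
qed

text \<open>By absorption the difference of the weights is \<open>Bernstein (Suc n) k p\<close>
  times the deviation of \<open>k\<close> from its mean, up to sign and the factor
  \<open>1 / ((n + 1) * (1 - p))\<close>. The sum is thus a mean absolute deviation, controlled by
  the variance.\<close>

lemma sum_abs_Bernstein_diff_le:
  assumes p: "0 \<le> p" "p < 1"
  shows "(\<Sum>k\<le>Suc n. \<bar>Bernstein n k p - Bernstein (Suc n) k p\<bar>) \<le> 1 / ((1 - p) * sqrt (real n + 1))"
proof -
  let ?N = "real n + 1"
  have nonneg: "Bernstein (Suc n) k p \<ge> 0" for k
    using p by (simp add: Bernstein_nonneg)
  have "(\<Sum>k\<le>Suc n. Bernstein (Suc n) k p * \<bar>real k - real (Suc n) * p\<bar>) \<le>
      (\<Sum>k\<le>Suc n. Bernstein (Suc n) k p * (((real k - real (Suc n) * p)\<^sup>2 / sqrt ?N + sqrt ?N) / 2))"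
    by (intro sum_mono mult_left_mono nonneg abs_le_half_weighted_square) simp
  also have "\<dots> = ((\<Sum>k\<le>Suc n. Bernstein (Suc n) k p * (real k - real (Suc n) * p)\<^sup>2) / sqrt ?N
      + (\<Sum>k\<le>Suc n. Bernstein (Suc n) k p) * sqrt ?N) / 2"
    unfolding sum_distrib_right sum_divide_distrib sum.distrib[symmetric]
    by (intro sum.cong refl) (simp add: algebra_simps add_divide_distrib)
  also have "\<dots> = (?N * p * (1 - p) / sqrt ?N + sqrt ?N) / 2"
    by (simp only: sum_Bernstein_variance sum_Bernstein) (simp add: algebra_simps)
  also have "\<dots> \<le> sqrt ?N"
  proof -
    have "?N * p * (1 - p) / sqrt ?N = sqrt ?N * (p * (1 - p))"
      by (simp add: field_simps)
    also have "\<dots> \<le> sqrt ?N * (1 * 1)"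
      using p by (intro mult_left_mono mult_mono) auto
    finally show ?thesis by simp
  qed
  finally have S: "(\<Sum>k\<le>Suc n. Bernstein (Suc n) k p * \<bar>real k - real (Suc n) * p\<bar>) \<le> sqrt ?N" .
  have "(\<Sum>k\<le>Suc n. \<bar>Bernstein n k p - Bernstein (Suc n) k p\<bar>) =
      (\<Sum>k\<le>Suc n. Bernstein (Suc n) k p * \<bar>real k - real (Suc n) * p\<bar>) / (?N * (1 - p))"
    unfolding sum_divide_distrib
  proof (intro sum.cong refl)
    fix k assume "k \<in> {..Suc n}"
    then have "?N * (1 - p) * (Bernstein n k p - Bernstein (Suc n) k p) =
        - (Bernstein (Suc n) k p * (real k - real (Suc n) * p))"
      using Bernstein_Suc_absorb[of k n p] by (simp add: algebra_simps)
    then have "\<bar>?N * (1 - p)\<bar> * \<bar>Bernstein n k p - Bernstein (Suc n) k p\<bar> =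
        \<bar>Bernstein (Suc n) k p\<bar> * \<bar>real k - real (Suc n) * p\<bar>"
      by (simp only: abs_mult[symmetric] abs_minus_cancel)
    moreover have D: "?N * (1 - p) > 0"
      using p by simp
    ultimately have "?N * (1 - p) * \<bar>Bernstein n k p - Bernstein (Suc n) k p\<bar> =
        Bernstein (Suc n) k p * \<bar>real k - real (Suc n) * p\<bar>"
      by (simp only: abs_of_pos[OF D] abs_of_nonneg[OF nonneg])
    then show "\<bar>Bernstein n k p - Bernstein (Suc n) k p\<bar> =
        Bernstein (Suc n) k p * \<bar>real k - real (Suc n) * p\<bar> / (?N * (1 - p))"
      using D by (metis less_irrefl nonzero_mult_div_cancel_left)
  qed
  also have "\<dots> \<le> sqrt ?N / (?N * (1 - p))"
    using p by (intro divide_right_mono S) simp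
  also have "\<dots> = sqrt ?N / ?N / (1 - p)"
    by simp
  also have "\<dots> = 1 / ((1 - p) * sqrt ?N)"
    by (simp add: sqrt_divide_self_eq inverse_eq_divide)
  finally show ?thesis .
qed

subsection \<open>Mixtures\<close>

text \<open>F = (1 - p) U + p V, tested on bounded Borel functions instead of sets: the identity is
  applied to the function that sends x to the G-measure of A - x.\<close>

definition mixture :: "real \<Rightarrow> 'a::topological_space measure \<Rightarrow> 'a measure \<Rightarrow> 'a measure \<Rightarrow> bool" where
  "mixture p U V F \<longleftrightarrow> (\<forall>f \<in> borel_measurable borel. \<forall>B. (\<forall>x. norm (f x) \<le> B) \<longrightarrow>
     integral\<^sup>L F f = (1 - p) * integral\<^sup>L U f + p * (integral\<^sup>L V f :: real))"

lemma measure_conv_mixture: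
  fixes U V F G :: "'a::{real_normed_vector, second_countable_topology} measure"
  assumes "borel_prob U" "borel_prob V" "borel_prob F" "borel_prob G" "mixture p U V F"
    and A: "A \<in> sets borel"
  shows "measure (conv F G) A = (1 - p) * measure (conv U G) A + p * measure (conv V G) A"
proof -
  interpret G: prob_space G
    using assms by (auto dest: borel_probD)
  note [measurable_cong] = borel_probD(2)[OF assms(4)] and [measurable] = A
  have [measurable]: "(\<lambda>x. \<integral>y. indicator A (x + y) \<partial>G :: real) \<in> borel_measurable borel"
    by measurable
  have "norm (\<integral>y. indicator A (x + y) \<partial>G :: real) \<le> 1" for x
  proof -
    have int: "integrable G (\<lambda>y. indicator A (x + y) :: real)"
      by (rule G.integrable_const_bound[where B = 1]) (auto simp: indicator_def)
    have "(\<integral>y. indicator A (x + y) \<partial>G :: real) \<le> 1"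
      by (rule G.integral_le_const[OF int]) (auto simp: indicator_def)
    moreover have "(\<integral>y. indicator A (x + y) \<partial>G :: real) \<ge> 0"
      by (rule Bochner_Integration.integral_nonneg) (auto simp: indicator_def)
    ultimately show ?thesis by simp
  qed
  then have "(\<integral>x. \<integral>y. indicator A (x + y) \<partial>G \<partial>F) =
      (1 - p) * (\<integral>x. \<integral>y. indicator A (x + y) \<partial>G \<partial>U) + p * (\<integral>x. \<integral>y. indicator A (x + y) \<partial>G \<partial>V :: real)"
    using assms(5) unfolding mixture_def by (elim ballE[where x = "\<lambda>x. \<integral>y. indicator A (x + y) \<partial>G :: real"] allE[where x = 1]) auto
  then show ?thesis
    using assms by (simp add: measure_conv)
qed

text \<open>The binomial theorem for the convolution power of (1 - p) U + p V. The spare factor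
  \<open>G\<close> is arbitrary so that the induction can move one factor \<open>F\<close> into
  it.\<close>

lemma measure_conv_power_mixture:
  fixes U V F G :: "'a::{real_normed_vector, second_countable_topology} measure"
  assumes "borel_prob U" "borel_prob V" "borel_prob F" "borel_prob G" "mixture p U V F"
    and A: "A \<in> sets borel"
  shows "measure (conv (conv_power F n) G) A =
    (\<Sum>k\<le>n. Bernstein n k p * measure (conv (conv_power U (n - k)) (conv (conv_power V k) G)) A)"
  using assms(4)
proof (induction n arbitrary: G)
  case 0
  then show ?case
    by (simp add: Bernstein_def conv_return_0 conv_commute[OF borel_prob_return] borel_prob_conv borel_prob_return)
next
  case (Suc n)
  define a where "a k = measure (conv (conv_power U (Suc n - k)) (conv (conv_power V k) G)) A" for k
  note bp = assms(1-3) Suc.prems borel_prob_conv borel_prob_conv_power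
  have "measure (conv (conv_power F (Suc n)) G) A = measure (conv (conv_power F n) (conv F G)) A"
    by (simp add: conv_assoc bp conv_left_commute[of F])
  also have "\<dots> = (\<Sum>k\<le>n. Bernstein n k p *
      measure (conv F (conv (conv_power U (n - k)) (conv (conv_power V k) G))) A)"
    by (subst Suc.IH) (simp_all add: conv_left_commute[of F] bp)
  also have "\<dots> = (\<Sum>k\<le>n. Bernstein n k p * ((1 - p) * a k + p * a (Suc k)))"
    by (intro sum.cong)
       (simp_all add: measure_conv_mixture[OF _ _ _ _ assms(5) A] bp a_def conv_assoc Suc_diff_le
          conv_left_commute[of V])
  also have "\<dots> = (\<Sum>k\<le>Suc n. Bernstein (Suc n) k p * a k)"
    by (rule sum_Bernstein_Suc[symmetric])
  finally show ?case by (simp add: a_def)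
qed

text \<open>Reduction from \<open>F\<close> to the component \<open>U\<close>. The hypothesis on one
  step is uniform in \<open>W\<close>, because \<open>W\<close> will be
  \<open>conv_power V k\<close> for every \<open>k\<close>.\<close>

lemma measure_conv_power_diff_le:
  fixes U V F :: "'a::{real_normed_vector, second_countable_topology} measure"
  assumes U: "borel_prob U" and V: "borel_prob V" and F: "borel_prob F" and mix: "mixture p U V F"
    and p: "0 \<le> p" "p < 1" and C: "C \<ge> 0" and A: "A \<in> sets borel"
    and step: "\<And>n W. borel_prob W \<Longrightarrow>
      \<bar>measure (conv (conv_power U n) W) A - measure (conv (conv_power U (Suc n)) W) A\<bar> \<le> C / sqrt (real n + 1)"
  shows "\<bar>measure (conv_power F n) A - measure (conv_power F (Suc n)) A\<bar> \<le> (C + 1) / ((1 - p) * sqrt (real n + 1))"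
proof -
  define a where "a i k = measure (conv (conv_power U i) (conv_power V k)) A" for i k
  note V_power = borel_prob_conv_power[OF V]
  have a_le: "\<bar>a i k\<bar> \<le> 1" for i k
    using prob_space.prob_le_1[OF borel_probD(1)[OF borel_prob_conv[OF borel_prob_conv_power[OF U] V_power]]]
    by (simp add: a_def)
  have expand: "measure (conv_power F n) A = (\<Sum>k\<le>n. Bernstein n k p * a (n - k) k)" for n
    using measure_conv_power_mixture[OF U V F borel_prob_return[of 0] mix A, of n]
    by (simp add: a_def conv_return_0 borel_prob_conv_power F V)
  \<comment> \<open>The weight of \<open>k = Suc n\<close> among \<open>n\<close> trials is 0, so
    both sums can run over the same range.\<close>
  have "(\<Sum>k\<le>n. Bernstein n k p * a (Suc n - k) k) = (\<Sum>k\<le>Suc n. Bernstein n k p * a (Suc n - k) k)"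
    by (simp add: Bernstein_def)
  \<comment> \<open>In the first sum the weights stay fixed and one factor \<open>U\<close> is
    added. In the second only the weights change, which costs their total variation.\<close>
  then have split: "measure (conv_power F n) A - measure (conv_power F (Suc n)) A =
      (\<Sum>k\<le>n. Bernstein n k p * (a (n - k) k - a (Suc n - k) k)) +
      (\<Sum>k\<le>Suc n. (Bernstein n k p - Bernstein (Suc n) k p) * a (Suc n - k) k)"
    unfolding expand right_diff_distrib left_diff_distrib sum_subtractf by linarith
  have "\<bar>measure (conv_power F n) A - measure (conv_power F (Suc n)) A\<bar> \<le> (\<Sum>k\<le>n. Bernstein n k p * \<bar>a (n - k) k - a (Suc n - k) k\<bar>) +
      (\<Sum>k\<le>Suc n. \<bar>Bernstein n k p - Bernstein (Suc n) k p\<bar> * \<bar>a (Suc n - k) k\<bar>)"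
    unfolding split
  proof (rule order_trans[OF abs_triangle_ineq], rule add_mono)
    show "\<bar>\<Sum>k\<le>n. Bernstein n k p * (a (n - k) k - a (Suc n - k) k)\<bar> \<le>
        (\<Sum>k\<le>n. Bernstein n k p * \<bar>a (n - k) k - a (Suc n - k) k\<bar>)"
      by (rule order_trans[OF sum_abs]) (use p in \<open>simp add: abs_mult Bernstein_nonneg\<close>)
    show "\<bar>\<Sum>k\<le>Suc n. (Bernstein n k p - Bernstein (Suc n) k p) * a (Suc n - k) k\<bar> \<le>
        (\<Sum>k\<le>Suc n. \<bar>Bernstein n k p - Bernstein (Suc n) k p\<bar> * \<bar>a (Suc n - k) k\<bar>)"
      by (rule order_trans[OF sum_abs]) (simp only: abs_mult order_refl)
  qed
  also have "\<dots> \<le> (\<Sum>k\<le>n. Bernstein n k p * (C * (1 / sqrt (real (n - k) + 1)))) +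
      (\<Sum>k\<le>Suc n. \<bar>Bernstein n k p - Bernstein (Suc n) k p\<bar> * 1)"
  proof (intro add_mono sum_mono mult_left_mono a_le abs_ge_zero)
    fix k assume "k \<in> {..n}"
    then show "\<bar>a (n - k) k - a (Suc n - k) k\<bar> \<le> C * (1 / sqrt (real (n - k) + 1))"
      using step[OF V_power[of k], of "n - k"] by (simp add: a_def Suc_diff_le)
  qed (use p in \<open>simp add: Bernstein_nonneg\<close>)
  also have "\<dots> = C * (\<Sum>k\<le>n. Bernstein n k p * (1 / sqrt (real (n - k) + 1))) +
      (\<Sum>k\<le>Suc n. \<bar>Bernstein n k p - Bernstein (Suc n) k p\<bar>)"
    unfolding sum_distrib_left by (simp add: mult.commute)
  also have "\<dots> \<le> C * (1 / ((1 - p) * sqrt (real n + 1))) + 1 / ((1 - p) * sqrt (real n + 1))"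
    by (intro add_mono mult_left_mono C sum_Bernstein_inverse_sqrt_le sum_abs_Bernstein_diff_le p)
  also have "\<dots> = (C + 1) / ((1 - p) * sqrt (real n + 1))"
    by (simp add: add_divide_distrib)
  finally show ?thesis .
qed

section \<open>Conditioning a law on a set of positive mass\<close>

lemma prob_space_density_bounded:
  assumes "prob_space F" and f: "f \<in> borel_measurable F" "\<And>x. 0 \<le> f x" "\<And>x. f x \<le> C" and "(\<integral>x. f x \<partial>F) = 1"
  shows "prob_space (density F (\<lambda>x. ennreal (f x)))"
proof
  interpret prob_space F by fact
  have "integrable F f"
    by (rule integrable_const_bound[where B = C]) (use f in auto)
  then show "emeasure (density F (\<lambda>x. ennreal (f x))) (space (density F (\<lambda>x. ennreal (f x)))) = 1"
    using f assms(5) by (simp add: emeasure_density nn_integral_eq_integral cong: nn_integral_cong)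
qed

text \<open>Only half of the mass on \<open>B\<close> goes to \<open>U\<close>, which keeps the weight \<open>p\<close> of \<open>V\<close> positive even if
  \<open>B\<close> has full measure.\<close>
lemma mixture_conditioned:
  fixes F :: "'a::topological_space measure"
  assumes F: "borel_prob F" and B: "B \<in> sets borel" and pos: "measure F B > 0"
  obtains U V p where "borel_prob U" "borel_prob V" "0 < p" "p < 1" "mixture p U V F"
    "\<And>Q. (AE x in U. Q x) \<longleftrightarrow> (AE x in F. x \<in> B \<longrightarrow> Q x)"
proof -
  interpret F: prob_space F by (rule borel_probD[OF F])
  note [measurable_cong] = borel_probD(2)[OF F] and [measurable] = B
  define \<beta> where "\<beta> = measure F B"
  have \<beta>: "0 < \<beta>" "\<beta> \<le> 1"
    using pos by (auto simp: \<beta>_def)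
  define p where "p = 1 - \<beta> / 2"
  have p: "0 < p" "p < 1"
    using \<beta> by (auto simp: p_def)
  \<comment> \<open>The densities of \<open>U\<close> and \<open>V\<close> with respect to
    \<open>F\<close>. As \<open>1 - p = \<beta> / 2\<close>, the weighted densities are half the
    indicator of \<open>B\<close> and its complement to 1.\<close>
  define u :: "'a \<Rightarrow> real" where "u x = indicator B x / \<beta>" for x
  define v :: "'a \<Rightarrow> real" where "v x = (1 - indicator B x / 2) / p" for x
  have [measurable]: "u \<in> borel_measurable F" "v \<in> borel_measurable F"
    unfolding u_def v_def by measurable
  have uv_nonneg: "u x \<ge> 0" "v x \<ge> 0" for x
    using \<beta> p by (auto simp: u_def v_def indicator_def)
  have uv_le: "u x \<le> 1 / \<beta>" "v x \<le> 1 / p" for x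
    using \<beta> p by (auto simp: u_def v_def indicator_def divide_right_mono)
  have intB: "integrable F (indicator B :: 'a \<Rightarrow> real)"
    by (rule F.integrable_const_bound[where B = 1]) (auto simp: indicator_def)
  have "(\<integral>x. indicator B x \<partial>F) = \<beta>"
    using borel_probD(3)[OF F] by (simp add: \<beta>_def)
  then have "(\<integral>x. u x \<partial>F) = 1" "(\<integral>x. v x \<partial>F) = 1"
    using intB \<beta> p by (simp_all add: u_def v_def F.prob_space) (simp add: p_def)
  define U where "U = density F (\<lambda>x. ennreal (u x))"
  define V where "V = density F (\<lambda>x. ennreal (v x))"
  have UV: "borel_prob U" "borel_prob V"
    unfolding borel_prob_def U_def V_def
    using prob_space_density_bounded[OF F.prob_space_axioms _ uv_nonneg(1) uv_le(1)]
      prob_space_density_bounded[OF F.prob_space_axioms _ uv_nonneg(2) uv_le(2)]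
      \<open>(\<integral>x. u x \<partial>F) = 1\<close> \<open>(\<integral>x. v x \<partial>F) = 1\<close> borel_probD(2)[OF F]
    by auto
  have mix: "mixture p U V F"
    unfolding mixture_def
  proof (intro ballI allI impI)
    fix f :: "'a \<Rightarrow> real" and C
    assume f [measurable]: "f \<in> borel_measurable borel" and C: "\<forall>x. norm (f x) \<le> C"
    have wint: "integrable F (\<lambda>x. w x * f x)"
      if [measurable]: "w \<in> borel_measurable F" and w: "\<And>x. 0 \<le> w x" "\<And>x. w x \<le> K" for w K
    proof (rule F.integrable_const_bound[where B = "K * C"])
      have "\<bar>w x * f x\<bar> \<le> K * C" for x
        unfolding abs_mult using w[of x] C[rule_format, of x] by (intro mult_mono) auto
      then show "AE x in F. norm (w x * f x) \<le> K * C"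
        by simp
    qed simp
    have int: "integrable F (\<lambda>x. u x * f x)" "integrable F (\<lambda>x. v x * f x)"
      by (rule wint[OF _ uv_nonneg(1) uv_le(1)] wint[OF _ uv_nonneg(2) uv_le(2)]; simp)+
    have "(1 - p) * u x + p * v x = 1" for x
      using \<beta> p by (simp add: u_def v_def p_def)
    then have "f x = (1 - p) * (u x * f x) + p * (v x * f x)" for x
      by (metis distrib_right mult.assoc mult_1)
    then have "integral\<^sup>L F f = (\<integral>x. (1 - p) * (u x * f x) + p * (v x * f x) \<partial>F)"
      by presburger
    also have "\<dots> = (1 - p) * (\<integral>x. u x * f x \<partial>F) + p * (\<integral>x. v x * f x \<partial>F)"
      using int by simp
    finally show "integral\<^sup>L F f = (1 - p) * integral\<^sup>L U f + p * integral\<^sup>L V f"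
      unfolding U_def V_def using uv_nonneg by (simp add: integral_density)
  qed
  have AE_U: "(AE x in U. Q x) \<longleftrightarrow> (AE x in F. x \<in> B \<longrightarrow> Q x)" for Q
    unfolding U_def using \<beta> by (subst AE_density) (auto simp: u_def indicator_def intro!: AE_cong)
  show thesis
    using UV p mix AE_U by (rule that)
qed

subsection \<open>Concentration\<close>

text \<open>Taylor expansion to fourth order. Giving up half of the quadratic term leaves room to
  absorb the remainder.\<close>

lemma cos_le_quadratic:
  fixes x :: real
  assumes "\<bar>x\<bar> \<le> 1"
  shows "cos x \<le> 1 - x\<^sup>2 / 4"
proof -
  obtain t where t: "cos x = (\<Sum>m<4. cos_coeff m * x ^ m) + (cos (t + 1/2 * real 4 * pi) / fact 4) * x ^ 4"
    using Maclaurin_cos_expansion[of x 4] by auto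
  have lessThan_four: "{..<4} = {0, 1, 2, 3 :: nat}"
    by auto
  have "(\<Sum>m<4. cos_coeff m * x ^ m) = 1 - x\<^sup>2 / 2"
    unfolding lessThan_four by (simp add: cos_coeff_def)
  moreover have "(cos (t + 1/2 * real 4 * pi) / fact 4) * x ^ 4 \<le> x\<^sup>2 / 4"
  proof -
    have "x ^ 4 = x\<^sup>2 * x\<^sup>2"
      by (simp add: eval_nat_numeral)
    also have "\<dots> \<le> x\<^sup>2 * 1"
      using assms by (intro mult_left_mono) (auto simp: abs_square_le_1)
    finally have x4: "x ^ 4 \<le> x\<^sup>2" by simp
    have "cos (t + 1/2 * real 4 * pi) / fact 4 \<le> 1 / 4"
      using order_trans[OF cos_le_one[of t], of 6] by (simp add: fact_numeral)
    then have "(cos (t + 1/2 * real 4 * pi) / fact 4) * x ^ 4 \<le> 1 / 4 * x ^ 4"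
      by (rule mult_right_mono) simp
    then show ?thesis using x4 by linarith
  qed
  ultimately show ?thesis using t by linarith
qed

text \<open>The Fourier transform of the triangular weight is nonnegative, which a flat weight would not give.\<close>
lemma integral_triangle_cos:
  fixes u :: real
  shows "(\<integral>s. (1 - s) * cos (s * u) * indicator {0..1} s \<partial>lborel) = (if u = 0 then 1 / 2 else (1 - cos u) / u\<^sup>2)"
proof (cases "u = 0")
  case True
  have "(\<integral>s. (1 - s) * indicator {0..1} s \<partial>lborel) = (\<lambda>s. s - s\<^sup>2 / 2) 1 - (\<lambda>s. s - s\<^sup>2 / 2) (0::real)"
    by (rule integral_FTC_Icc_real) (auto intro!: derivative_eq_intros continuous_intros)
  then show ?thesis using True by simp
next
  case False
  let ?F = "\<lambda>s. (1 - s) * sin (s * u) / u - cos (s * u) / u\<^sup>2"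
  have "(\<integral>s. (1 - s) * cos (s * u) * indicator {0..1} s \<partial>lborel) = ?F 1 - ?F 0"
    by (rule integral_FTC_Icc_real)
       (use False in \<open>auto intro!: derivative_eq_intros continuous_intros simp: power2_eq_square field_simps\<close>)
  then show ?thesis using False by (simp add: diff_divide_distrib)
qed

text \<open>On [-1, 1] the quadratic bound on the cosine gives 1/4; elsewhere nonnegativity of the
  transform suffices.\<close>

lemma integral_triangle_cos_ge:
  fixes u :: real
  shows "indicator {-1..1} u / 4 \<le> (\<integral>s. (1 - s) * cos (s * u) * indicator {0..1} s \<partial>lborel)"
  unfolding integral_triangle_cos
proof (cases "u = 0")
  case False
  have "u\<^sup>2 / 4 \<le> 1 - cos u" if "\<bar>u\<bar> \<le> 1"
    using cos_le_quadratic[OF that] by simp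
  then show "indicator {-1..1} u / 4 \<le> (if u = 0 then 1 / 2 else (1 - cos u) / u\<^sup>2)"
    using False cos_le_one[of u] by (auto simp: indicator_def field_simps)
qed (simp add: indicator_def)

text \<open>Esseen's inequality. The indicator of the interval is at most 4 times the triangle
  transform at \<open>(x - b) / R\<close>, and Fubini turns the mean of that transform into an
  integral of the characteristic function.\<close>

lemma (in real_distribution) concentration_le_char:
  assumes "R > 0"
  shows "measure M {x. \<bar>x - b\<bar> \<le> R} \<le> 4 * (\<integral>s. norm (char M (s / R)) * indicator {0..1} s \<partial>lborel)"
proof -
  \<comment> \<open>Lebesgue measure on [0, 1] is a probability measure, so boundedness alone gives
    integrability on the product.\<close>
  define L where "L = restrict_space lborel {0..1::real}"
  have L_int: "integral\<^sup>L L f = (\<integral>s. f s * indicator {0..1} s \<partial>lborel)" for f :: "real \<Rightarrow> real"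
    unfolding L_def by (subst integral_restrict_space) (auto simp: mult.commute)
  have [measurable]: "(\<lambda>x. x) \<in> borel_measurable L"
    unfolding L_def by (simp add: measurable_restrict_space1)
  have spL: "space L = {0..1}"
    unfolding L_def by (simp add: space_restrict_space)
  have emL: "emeasure L (space L) = 1"
    unfolding spL by (simp add: L_def emeasure_restrict_space)
  interpret L: prob_space L
    by standard (rule emL)
  interpret P: pair_prob_space M L ..
  let ?k = "\<lambda>x s. (1 - s) * cos (s * ((x - b) / R))"
  have k_le: "\<bar>?k x s\<bar> \<le> 1" if "s \<in> {0..1}" for x s
  proof -
    have "\<bar>?k x s\<bar> \<le> 1 * 1"
      unfolding abs_mult using that by (intro mult_mono) auto
    then show ?thesis by simp
  qed
  have k_int: "integrable (M \<Otimes>\<^sub>M L) (case_prod ?k)"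
  proof (rule P.integrable_const_bound[where B = 1])
    show "AE z in M \<Otimes>\<^sub>M L. norm (case z of (x, s) \<Rightarrow> ?k x s) \<le> 1"
    proof (rule AE_I2)
      fix z assume "z \<in> space (M \<Otimes>\<^sub>M L)"
      then have "snd z \<in> {0..1}"
        by (simp add: space_pair_measure spL mem_Times_iff)
      from k_le[OF this, of "fst z"] show "norm (case z of (x, s) \<Rightarrow> ?k x s) \<le> 1"
        by (simp add: case_prod_unfold)
    qed
  qed simp
  have k_intM: "integrable M (\<lambda>x. ?k x s)" if "s \<in> {0..1}" for s
    by (rule integrable_const_bound[where B = 1]) (use k_le[OF that] in auto)
  \<comment> \<open>The centre \<open>b\<close> enters only through a phase factor of modulus 1, so
    the bound is uniform in \<open>b\<close>.\<close>
  have inner_le: "(\<integral>x. ?k x s \<partial>M) \<le> norm (char M (s / R))" if s: "s \<in> {0..1}" for s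
  proof -
    have c: "complex_integrable M (\<lambda>x. iexp (s / R * x))"
      by (intro integrable_iexp) auto
    have "(\<integral>x. ?k x s \<partial>M) = (\<integral>x. Re ((1 - s) * iexp (- s * b / R) * iexp (s / R * x)) \<partial>M)"
    proof (intro Bochner_Integration.integral_cong refl)
      fix x
      have "s * ((x - b) / R) = - s * b / R + s / R * x"
        using assms by (simp add: field_simps)
      then show "?k x s = Re ((1 - s) * iexp (- s * b / R) * iexp (s / R * x))"
        unfolding mult.assoc exp_add[symmetric]
        by (simp add: Re_exp distrib_left[symmetric] del: of_real_add flip: of_real_add)
    qed
    also have "\<dots> = Re (\<integral>x. (1 - s) * iexp (- s * b / R) * iexp (s / R * x) \<partial>M)"
      by (rule integral_Re) (use c in auto)
    also have "\<dots> = Re ((1 - s) * iexp (- s * b / R) * char M (s / R))"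
      unfolding char_def by simp
    also have "\<dots> \<le> norm ((1 - s) * iexp (- s * b / R) * char M (s / R))"
      by (rule complex_Re_le_cmod)
    also have "\<dots> = (1 - s) * norm (char M (s / R))"
      using s by (simp add: norm_mult del: of_real_diff)
    also have "\<dots> \<le> 1 * norm (char M (s / R))"
      using s by (intro mult_right_mono) auto
    finally show ?thesis by simp
  qed
  have ind: "indicator {x. \<bar>x - b\<bar> \<le> R} x / 4 \<le> (\<integral>s. ?k x s \<partial>L)" for x
  proof -
    have "indicator {x. \<bar>x - b\<bar> \<le> R} x = (indicator {-1..1} ((x - b) / R) :: real)"
      using assms by (auto simp: indicator_def field_simps abs_le_iff)
    then show ?thesis
      using integral_triangle_cos_ge[of "(x - b) / R"] by (simp add: L_int)
  qed
  have "measure M {x. \<bar>x - b\<bar> \<le> R} / 4 = (\<integral>x. indicator {x. \<bar>x - b\<bar> \<le> R} x / 4 \<partial>M)"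
    by simp
  also have "\<dots> \<le> (\<integral>x. \<integral>s. ?k x s \<partial>L \<partial>M)"
    by (rule integral_mono[OF _ P.integrable_fst[OF k_int] ind])
       (auto intro!: integrable_const_bound[where B = 1] simp: indicator_def)
  also have "\<dots> = (\<integral>s. \<integral>x. ?k x s \<partial>M \<partial>L)"
    by (rule P.Fubini_integral[OF k_int, symmetric])
  also have "\<dots> \<le> (\<integral>s. norm (char M (s / R)) \<partial>L)"
  proof (rule integral_mono)
    show "integrable L (\<lambda>s. \<integral>x. ?k x s \<partial>M)"
      by (rule P.integrable_snd[OF k_int])
    show "integrable L (\<lambda>s. norm (char M (s / R)))"
      by (rule L.integrable_const_bound[where B = 1]) (auto simp: cmod_char_le_1)
  qed (use inner_le in \<open>simp add: spL\<close>)
  finally show ?thesis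
    by (simp add: L_int)
qed

section \<open>Decay of powers of a characteristic function\<close>

lemma integral_inverse_quadratic_le:
  fixes a :: real
  assumes "a > 0"
  shows "integrable lborel (\<lambda>s. 1 / (1 + a * s\<^sup>2) * indicator {0..1} s)"
    and "(\<integral>s. 1 / (1 + a * s\<^sup>2) * indicator {0..1} s \<partial>lborel) \<le> 2 / sqrt a"
proof -
  \<comment> \<open>A primitive of the integrand. With \<open>a\<close> proportional to the number
    of factors, its factor \<open>1 / sqrt a\<close> is the source of the order n^(-1/2).\<close>
  let ?F = "\<lambda>s. arctan (sqrt a * s) / sqrt a"
  have pos: "1 + a * s\<^sup>2 > 0" for s
    using assms by (simp add: add_pos_nonneg)
  have ne: "1 + a * s\<^sup>2 \<noteq> 0" for s
    using pos[of s] by simp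
  have D: "(?F has_real_derivative 1 / (1 + a * s\<^sup>2)) (at s)" for s
    using assms ne[of s] by (auto intro!: derivative_eq_intros simp: power_mult_distrib divide_simps)
  have "has_bochner_integral lborel (\<lambda>s. 1 / (1 + a * s\<^sup>2) * indicator {0..1} s) (?F 1 - ?F 0)"
    by (rule has_bochner_integral_FTC_Icc_real[OF _ D]) (auto intro!: continuous_intros simp: ne)
  moreover have "?F 1 - ?F 0 \<le> 2 / sqrt a"
    using arctan_ubound[of "sqrt a"] pi_less_4 assms by (simp add: divide_right_mono)
  ultimately show "integrable lborel (\<lambda>s. 1 / (1 + a * s\<^sup>2) * indicator {0..1} s)"
    and "(\<integral>s. 1 / (1 + a * s\<^sup>2) * indicator {0..1} s \<partial>lborel) \<le> 2 / sqrt a"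
    by (auto simp: has_bochner_integral_iff)
qed

text \<open>Bernoulli's inequality together with (1 - x)(1 + x) \<le> 1. The bound plays the part of
  exp (-n x) but leads to an arctangent integral.\<close>

lemma power_one_minus_le:
  fixes x :: real
  assumes "0 \<le> x" "x \<le> 1"
  shows "(1 - x) ^ n \<le> 1 / (1 + real n * x)"
proof (cases "x = 1")
  case False
  have "(1 - x) ^ n * (1 + real n * x) \<le> (1 - x) ^ n * (1 + x) ^ n"
    using assms Bernoulli_inequality[of x n] by (intro mult_left_mono) auto
  also have "\<dots> = (1 - x\<^sup>2) ^ n"
    by (simp add: power_mult_distrib[symmetric] power2_eq_square algebra_simps)
  also have "\<dots> \<le> 1"
    using assms by (intro power_le_one) (auto simp: power_le_one)
  finally show ?thesis
    using assms by (simp add: field_simps add_pos_nonneg)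
qed (cases n, simp_all)

text \<open>Since \<open>\<bar>char D s\<bar>\<^sup>2\<close> is the mean of \<open>cos (s * (x - y))\<close> over independent \<open>x\<close> and \<open>y\<close>,
  the constant \<open>w\<close> is a quarter of the variance.\<close>
lemma (in real_distribution) norm_char_le_quadratic:
  assumes bdd: "AE x in M. \<bar>x\<bar> \<le> R" and nondeg: "\<And>a. \<not> (AE x in M. x = a)"
  shows "\<exists>w>0. \<forall>s. \<bar>s\<bar> * (2 * R) \<le> 1 \<longrightarrow> norm (char M s) \<le> 1 - w * s\<^sup>2"
proof -
  define m where "m = expectation (\<lambda>x. x)"
  define m2 where "m2 = expectation (\<lambda>x. x\<^sup>2)"
  define v where "v = expectation (\<lambda>x. (x - m)\<^sup>2)"
  have int1: "integrable M (\<lambda>x. x)"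
    by (rule integrable_const_bound[OF _ , where B = R]) (use bdd in auto)
  have int2: "integrable M (\<lambda>x. x\<^sup>2)"
  proof (rule integrable_const_bound[where B = "R\<^sup>2"])
    show "AE x in M. norm (x\<^sup>2) \<le> R\<^sup>2"
      using bdd by eventually_elim (simp add: abs_le_square_iff[symmetric])
  qed simp
  have intv: "integrable M (\<lambda>x. (x - m)\<^sup>2)"
    unfolding power2_diff using int1 int2 by simp
  have v_eq: "v = m2 - m\<^sup>2"
    unfolding v_def power2_diff using int1 int2
    by (simp add: m_def[symmetric] m2_def[symmetric] prob_space power2_eq_square[of m] algebra_simps del: space_eq_univ)
  have "v \<noteq> 0"
  proof
    assume "v = 0"
    then have "AE x in M. (x - m)\<^sup>2 = 0"
      unfolding v_def by (subst (asm) integral_nonneg_eq_0_iff_AE[OF intv]) auto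
    then have "AE x in M. x = m" by simp
    then show False using nondeg by blast
  qed
  moreover have "v \<ge> 0"
    unfolding v_def by (rule Bochner_Integration.integral_nonneg) simp
  ultimately have v: "v > 0" by simp
  have main: "norm (char M s) \<le> 1 - v / 4 * s\<^sup>2" if s: "\<bar>s\<bar> * (2 * R) \<le> 1" for s
  proof -
    define c where "c = expectation (\<lambda>x. cos (s * x))"
    define d where "d = expectation (\<lambda>x. sin (s * x))"
    have intc: "integrable M (\<lambda>x. cos (s * x))" and intd: "integrable M (\<lambda>x. sin (s * x))"
      by (auto intro!: integrable_const_bound[where B = 1])
    have ci: "complex_integrable M (\<lambda>x. iexp (s * x))"
      by (intro integrable_iexp) auto
    have "Re (char M s) = c" "Im (char M s) = d"
      unfolding char_def c_def d_def integral_Re[OF ci, symmetric] integral_Im[OF ci, symmetric]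
      by (simp_all add: Re_exp Im_exp)
    then have norm_eq: "(norm (char M s))\<^sup>2 = c\<^sup>2 + d\<^sup>2"
      by (simp add: cmod_power2)
    \<comment> \<open>The squared modulus is the mean over \<open>x\<close> of
      \<open>cos (s * x) * c + sin (s * x) * d\<close>. Here \<open>x\<close> is fixed and the
      independent copy \<open>y\<close> is averaged out, so that no product measure is
      formed.\<close>
    have pt: "cos (s * x) * c + sin (s * x) * d \<le> 1 - s\<^sup>2 / 4 * (x\<^sup>2 - 2 * x * m + m2)"
      if x: "\<bar>x\<bar> \<le> R" for x
    proof -
      have "cos (s * x) * c + sin (s * x) * d = expectation (\<lambda>y. cos (s * x) * cos (s * y) + sin (s * x) * sin (s * y))"
        unfolding c_def d_def using intc intd by simp
      also have "\<dots> \<le> expectation (\<lambda>y. 1 - s\<^sup>2 / 4 * (x\<^sup>2 - 2 * x * y + y\<^sup>2))"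
      proof (rule integral_mono_AE)
        show "AE y in M. cos (s * x) * cos (s * y) + sin (s * x) * sin (s * y) \<le> 1 - s\<^sup>2 / 4 * (x\<^sup>2 - 2 * x * y + y\<^sup>2)"
          using bdd
        proof eventually_elim
          case (elim y)
          have "\<bar>s * x - s * y\<bar> = \<bar>s\<bar> * \<bar>x - y\<bar>"
            by (simp add: abs_mult flip: right_diff_distrib)
          also have "\<dots> \<le> \<bar>s\<bar> * (2 * R)"
            using x elim by (intro mult_left_mono) auto
          finally have "cos (s * x - s * y) \<le> 1 - (s * x - s * y)\<^sup>2 / 4"
            using s by (intro cos_le_quadratic) simp
          moreover have "(s * x - s * y)\<^sup>2 / 4 = s\<^sup>2 / 4 * (x\<^sup>2 - 2 * x * y + y\<^sup>2)"
            by (simp add: power2_eq_square field_simps)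
          ultimately show ?case
            unfolding cos_diff by simp
        qed
      qed (use int1 int2 intc intd in auto)
      also have "\<dots> = 1 - s\<^sup>2 / 4 * (x\<^sup>2 - 2 * x * m + m2)"
        using int1 int2 by (simp add: m_def m2_def prob_space del: space_eq_univ)
      finally show ?thesis .
    qed
    have "c\<^sup>2 + d\<^sup>2 = expectation (\<lambda>x. cos (s * x) * c + sin (s * x) * d)"
      using intc intd by (simp add: c_def d_def power2_eq_square)
    also have "\<dots> \<le> expectation (\<lambda>x. 1 - s\<^sup>2 / 4 * (x\<^sup>2 - 2 * x * m + m2))"
      by (rule integral_mono_AE) (use int1 int2 intc intd bdd pt in auto)
    also have "\<dots> = 1 - s\<^sup>2 / 4 * (m2 - 2 * m * m + m2)"
      using int1 int2 by (simp add: m_def m2_def prob_space del: space_eq_univ)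
    also have "\<dots> = 1 - v / 2 * s\<^sup>2"
      by (simp add: v_eq power2_eq_square field_simps)
    finally have le: "(norm (char M s))\<^sup>2 \<le> 1 - v / 2 * s\<^sup>2"
      using norm_eq by simp
    also have "\<dots> \<le> (1 - v / 4 * s\<^sup>2)\<^sup>2"
      by (simp add: power2_diff)
    finally have "(norm (char M s))\<^sup>2 \<le> (1 - v / 4 * s\<^sup>2)\<^sup>2" .
    \<comment> \<open>Nonnegativity is needed to take square roots; it follows from the bound on the
      squared modulus just proved.\<close>
    moreover have "0 \<le> 1 - v / 4 * s\<^sup>2"
      using order_trans[OF zero_le_power2 le] v by (simp add: field_simps)
    ultimately show ?thesis
      by (rule power2_le_imp_le)
  qed
  show ?thesis
    using v main by (intro exI[of _ "v / 4"]) auto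
qed

section \<open>One-dimensional marginals of convolution powers\<close>

abbreviation marginal :: "'a::real_inner measure \<Rightarrow> 'a \<Rightarrow> real measure" where
  "marginal G t \<equiv> distr G borel (\<lambda>x. inner x t)"

lemma measurable_inner_borel_prob:
  fixes G :: "'a::{real_inner, second_countable_topology} measure"
  assumes "borel_prob G"
  shows "(\<lambda>x. inner x t) \<in> borel_measurable G"
  by (simp add: measurable_cong_sets[OF borel_probD(2)[OF assms] refl])

lemma real_distribution_marginal:
  fixes G :: "'a::{real_inner, second_countable_topology} measure"
  assumes "borel_prob G"
  shows "real_distribution (marginal G t)"
  by (intro prob_space.real_distribution_distr borel_probD[OF assms] measurable_inner_borel_prob assms)

lemma char_marginal:
  fixes G :: "'a::{real_inner, second_countable_topology} measure"
  assumes "borel_prob G"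
  shows "char (marginal G t) s = (\<integral>x. iexp (s * inner x t) \<partial>G)"
  unfolding char_def by (rule integral_distr[OF measurable_inner_borel_prob[OF assms]]) simp

lemma char_marginal_conv:
  fixes M N :: "'a::{real_inner, second_countable_topology} measure"
  assumes "borel_prob M" "borel_prob N"
  shows "char (marginal (conv M N) t) s = char (marginal M t) s * char (marginal N t) s"
proof -
  have "(\<integral>x. iexp (s * inner x t) \<partial>conv M N) = (\<integral>x. \<integral>y. iexp (s * inner (x + y) t) \<partial>N \<partial>M)"
    by (rule integral_conv[OF assms, where B = 1]) auto
  also have "\<dots> = (\<integral>x. \<integral>y. iexp (s * inner x t) * iexp (s * inner y t) \<partial>N \<partial>M)"
    by (simp add: inner_add_left distrib_left exp_add)
  also have "\<dots> = (\<integral>x. iexp (s * inner x t) \<partial>M) * (\<integral>y. iexp (s * inner y t) \<partial>N)"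
    by simp
  finally show ?thesis
    by (simp add: char_marginal assms borel_prob_conv)
qed

text \<open>Characteristic functions of the marginals multiply, and the factor from \<open>W\<close>
  has modulus at most 1. Hence no later bound depends on \<open>W\<close>.\<close>

lemma norm_char_marginal_conv_power_le:
  fixes U W :: "'a::{real_inner, second_countable_topology} measure"
  assumes U: "borel_prob U" and W: "borel_prob W"
  shows "norm (char (marginal (conv (conv_power U n) W) t) s) \<le> norm (char (marginal U t) s) ^ n"
proof (induction n)
  case 0
  show ?case
    using real_distribution.cmod_char_le_1[OF real_distribution_marginal[OF borel_prob_conv[OF borel_prob_return W]]]
    by simp
next
  case (Suc n)
  have "conv (conv_power U (Suc n)) W = conv U (conv (conv_power U n) W)"
    by (simp add: conv_assoc assms borel_prob_conv_power)
  then have "norm (char (marginal (conv (conv_power U (Suc n)) W) t) s) =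
      norm (char (marginal U t) s) * norm (char (marginal (conv (conv_power U n) W) t) s)"
    by (simp add: char_marginal_conv norm_mult assms borel_prob_conv borel_prob_conv_power)
  also have "\<dots> \<le> norm (char (marginal U t) s) * norm (char (marginal U t) s) ^ n"
    by (intro mult_left_mono Suc.IH) simp
  finally show ?case by simp
qed

lemma AE_marginal_iff:
  fixes G :: "'a::{real_inner, second_countable_topology} measure"
  assumes "borel_prob G" "{x. P x} \<in> sets borel"
  shows "(AE x in marginal G t. P x) \<longleftrightarrow> (AE x in G. P (inner x t))"
  using assms(2) by (subst AE_distr_iff[OF measurable_inner_borel_prob[OF assms(1)]]) auto

text \<open>Esseen's inequality is applied to the marginal along \<open>t\<close>, whose
  characteristic function is dominated by the \<open>n\<close>-th power of that of \<open>U\<close>.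
  The radius is the largest displacement along \<open>t\<close> that a vector of norm at most
  \<open>\<rho>\<close> can cause.\<close>

lemma concentration_conv_power:
  fixes U :: "'a::{real_inner, second_countable_topology} measure"
  assumes U: "borel_prob U" and bdd: "AE x in U. norm x \<le> \<rho>" and \<rho>: "\<rho> > 0"
    and nondeg: "\<And>a. \<not> (AE x in U. inner x t = a)"
  shows "\<exists>C>0. \<forall>n W b. borel_prob W \<longrightarrow>
    measure (conv (conv_power U n) W) {x. \<bar>inner x t - b\<bar> \<le> \<rho> * norm t} \<le> C / sqrt (real n + 1)"
proof -
  have "t \<noteq> 0"
    using nondeg[of 0] by auto
  define r where "r = \<rho> * norm t"
  have r: "r > 0"
    using \<open>t \<noteq> 0\<close> \<rho> by (simp add: r_def)
  interpret D: real_distribution "marginal U t"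
    by (rule real_distribution_marginal[OF U])
  have "AE x in U. \<bar>inner x t\<bar> \<le> r"
    using bdd
  proof eventually_elim
    case (elim x)
    have "\<bar>inner x t\<bar> \<le> norm x * norm t"
      by (rule Cauchy_Schwarz_ineq2)
    also have "\<dots> \<le> r"
      unfolding r_def using elim by (intro mult_right_mono) auto
    finally show ?case .
  qed
  then have "AE x in marginal U t. \<bar>x\<bar> \<le> r"
    by (subst AE_marginal_iff[OF U]) auto
  moreover have "\<not> (AE x in marginal U t. x = a)" for a
    using nondeg[of a] by (subst AE_marginal_iff[OF U]) auto
  ultimately obtain w where w: "w > 0"
    and char_le: "\<And>s. \<bar>s\<bar> * (2 * r) \<le> 1 \<Longrightarrow> norm (char (marginal U t) s) \<le> 1 - w * s\<^sup>2"
    using D.norm_char_le_quadratic[of r] by blast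
  \<comment> \<open>The constant \<open>w\<close> after rescaling to the frequency
    \<open>s / (2 * r)\<close>. For \<open>s\<close> in [0, 1] these frequencies are ones where the
    quadratic bound is valid.\<close>
  define a where "a = w / (2 * r)\<^sup>2"
  have a: "a > 0"
    using w r by (simp add: a_def)
  have char_le': "norm (char (marginal (conv (conv_power U n) W) t) (s / (2 * r))) \<le> 1 / (1 + real n * a * s\<^sup>2)"
    if W: "borel_prob W" and s: "s \<in> {0..1}" for n s W
  proof -
    have 1: "norm (char (marginal U t) (s / (2 * r))) \<le> 1 - a * s\<^sup>2"
      using char_le[of "s / (2 * r)"] s r by (simp add: a_def power_divide)
    have "norm (char (marginal (conv (conv_power U n) W) t) (s / (2 * r))) \<le> norm (char (marginal U t) (s / (2 * r))) ^ n"
      by (rule norm_char_marginal_conv_power_le[OF U W])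
    also have "\<dots> \<le> (1 - a * s\<^sup>2) ^ n"
      by (intro power_mono 1) simp
    also have "\<dots> \<le> 1 / (1 + real n * (a * s\<^sup>2))"
      using order_trans[OF norm_ge_zero 1] a by (intro power_one_minus_le) auto
    finally show ?thesis by (simp add: mult.assoc)
  qed
  \<comment> \<open>12 is 4 from Esseen, times 2 from the arctangent, times 3/2 for passing from
    \<open>n\<close> to \<open>n + 1\<close> when \<open>n\<close> is positive. The summand 1 covers
    \<open>n = 0\<close>.\<close>
  have bound: "measure (conv (conv_power U n) W) {x. \<bar>inner x t - b\<bar> \<le> r} \<le> (12 / sqrt a + 1) / sqrt (real n + 1)"
    if W: "borel_prob W" for n W b
  proof (cases "n = 0")
    case True
    interpret G: prob_space "conv (conv_power U n) W"
      by (intro borel_probD borel_prob_conv borel_prob_conv_power U W)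
    have "measure (conv (conv_power U n) W) {x. \<bar>inner x t - b\<bar> \<le> r} \<le> 1"
      by (rule G.prob_le_1)
    then show ?thesis
      using True a by (simp add: add_increasing)
  next
    case False
    let ?G = "conv (conv_power U n) W"
    have G: "borel_prob ?G"
      by (intro borel_prob_conv borel_prob_conv_power U W)
    interpret X: real_distribution "marginal ?G t"
      by (rule real_distribution_marginal[OF G])
    have pos: "real n * a > 0"
      using False a by simp
    have "measure ?G {x. \<bar>inner x t - b\<bar> \<le> r} = measure (marginal ?G t) {x. \<bar>x - b\<bar> \<le> r}"
      using borel_probD(3)[OF G]
      by (subst measure_distr[OF measurable_inner_borel_prob[OF G]]) (auto simp: vimage_def)
    \<comment> \<open>The window is widened to \<open>2 * r\<close> to keep the frequencies in
      Esseen's integral within the admissible range.\<close>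
    also have "\<dots> \<le> measure (marginal ?G t) {x. \<bar>x - b\<bar> \<le> 2 * r}"
      using r by (intro X.finite_measure_mono) auto
    also have "\<dots> \<le> 4 * (\<integral>s. norm (char (marginal ?G t) (s / (2 * r))) * indicator {0..1} s \<partial>lborel)"
      using r by (intro X.concentration_le_char) simp
    also have "(\<integral>s. norm (char (marginal ?G t) (s / (2 * r))) * indicator {0..1} s \<partial>lborel) \<le>
        (\<integral>s. 1 / (1 + real n * a * s\<^sup>2) * indicator {0..1} s \<partial>lborel)"
    proof (rule integral_mono')
      show "integrable lborel (\<lambda>s. 1 / (1 + real n * a * s\<^sup>2) * indicator {0..1} s)"
        by (rule integral_inverse_quadratic_le[OF pos])
    qed (use char_le'[OF W] a in \<open>auto simp: indicator_def\<close>)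
    also have "\<dots> \<le> 2 / sqrt (real n * a)"
      by (rule integral_inverse_quadratic_le[OF pos])
    finally have "measure ?G {x. \<bar>inner x t - b\<bar> \<le> r} \<le> 8 / sqrt a * (1 / sqrt (real n))"
      by (simp add: real_sqrt_mult mult.commute)
    moreover have "8 / sqrt a * (1 / sqrt (real n)) \<le> 8 / sqrt a * (3 / 2 * (1 / sqrt (real n + 1)))"
    proof (intro mult_left_mono)
      have "sqrt (real n + 1) \<le> sqrt ((3 / 2)\<^sup>2 * real n)"
        using False by (intro real_sqrt_le_mono) (auto simp: power2_eq_square)
      also have "\<dots> = 3 / 2 * sqrt (real n)"
        by (simp add: real_sqrt_mult)
      finally show "1 / sqrt (real n) \<le> 3 / 2 * (1 / sqrt (real n + 1))"
        using False by (simp add: field_simps)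
    qed (use a in simp)
    moreover have "12 / sqrt a * (1 / sqrt (real n + 1)) \<le> (12 / sqrt a + 1) * (1 / sqrt (real n + 1))"
      by (intro mult_right_mono) auto
    ultimately show ?thesis
      by simp
  qed
  have "12 / sqrt a + 1 > 0"
    using a by (simp add: add_pos_pos)
  then show ?thesis
    using bound unfolding r_def by (intro exI[of _ "12 / sqrt a + 1"] conjI allI impI)
qed

section \<open>Crossing the faces of a polyhedron\<close>

lemma polyhedron_borel:
  fixes t :: "'i \<Rightarrow> 'a::{real_inner, second_countable_topology}"
  assumes "finite I"
  shows "{x. \<forall>j\<in>I. ereal (inner x (t j)) \<le> b j} \<in> sets borel"
proof -
  have "{x. ereal (inner x (t j)) \<le> b j} \<in> sets borel" for j
    by (cases "b j") auto
  then have "{x \<in> space borel. \<forall>j\<in>I. ereal (inner x (t j)) \<le> b j} \<in> sets borel"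
    by (intro sets.sets_Collect_finite_All assms) simp
  then show ?thesis by simp
qed

text \<open>A step \<open>y\<close> drawn from \<open>U\<close> can cross the face \<open>j\<close>
  only if \<open>inner y (t j)\<close> is nonzero, hence almost surely only for \<open>j\<close> in
  \<open>J\<close>, and only if the starting point lies in a strip around that face. A union bound
  over the strips remains.\<close>

lemma measure_conv_polyhedron_le:
  fixes U G :: "'a::{real_inner, second_countable_topology} measure"
  assumes U: "borel_prob U" and G: "borel_prob G" and I: "finite I" and J: "J \<subseteq> I"
    and bdd: "AE y in U. norm y \<le> \<rho>"
    and zero: "\<And>j. j \<in> I - J \<Longrightarrow> AE y in U. inner y (t j) = 0"
    and P: "P = {x. \<forall>j\<in>I. ereal (inner x (t j)) \<le> b j}"
  shows "\<bar>measure G P - measure (conv U G) P\<bar> \<le>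
    (\<Sum>j\<in>J. measure G {x. \<bar>inner x (t j) - real_of_ereal (b j)\<bar> \<le> \<rho> * norm (t j)})"
proof -
  define A where "A j = {x. \<bar>inner x (t j) - real_of_ereal (b j)\<bar> \<le> \<rho> * norm (t j)}" for j
  have finJ: "finite J"
    using J I by (rule finite_subset)
  interpret U: prob_space U by (rule borel_probD[OF U])
  interpret G: prob_space G by (rule borel_probD[OF G])
  note [measurable_cong] = borel_probD(2)[OF U] borel_probD(2)[OF G]
  have P_borel [measurable]: "P \<in> sets borel"
    unfolding P by (rule polyhedron_borel[OF I])
  have A_borel [measurable]: "A j \<in> sets borel" for j
    unfolding A_def by measurable
  define S :: "'a \<Rightarrow> real" where "S x = (\<Sum>j\<in>J. indicator (A j) x)" for x
  have S_nonneg: "S x \<ge> 0" for x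
    by (simp add: S_def sum_nonneg)
  have S_int: "integrable G S"
    unfolding S_def
    by (intro Bochner_Integration.integrable_sum G.integrable_const_bound[where B = 1]) (auto simp: indicator_def)
  have AE_U: "AE y in U. norm y \<le> \<rho> \<and> (\<forall>j\<in>I - J. inner y (t j) = 0)"
  proof (rule AE_conjI[OF bdd])
    show "AE y in U. \<forall>j\<in>I - J. inner y (t j) = 0"
      by (rule AE_finite_allI) (use I zero in auto)
  qed
  have crossing: "\<bar>indicator P x - indicator P (x + y)\<bar> \<le> S x"
    if y: "norm y \<le> \<rho>" "\<forall>j\<in>I - J. inner y (t j) = 0" for x y
  proof (cases "x \<in> P \<longleftrightarrow> x + y \<in> P")
    case True
    then show ?thesis
      using S_nonneg by (simp add: indicator_def)
  next
    case False
    then obtain j where j: "j \<in> I"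
      and ne: "(ereal (inner x (t j)) \<le> b j) \<noteq> (ereal (inner (x + y) (t j)) \<le> b j)"
      unfolding P by blast
    have "inner y (t j) \<noteq> 0"
      using ne by (auto simp: inner_add_left)
    then have "j \<in> J"
      using j y by auto
    \<comment> \<open>Only a finite \<open>b j\<close> can separate \<open>x\<close> from
      \<open>x + y\<close>, so the default value of \<open>real_of_ereal\<close> at infinite bounds
      does no harm.\<close>
    have "\<bar>inner x (t j) - real_of_ereal (b j)\<bar> \<le> \<bar>inner y (t j)\<bar>"
      using ne by (cases "b j") (auto simp: inner_add_left)
    also have "\<dots> \<le> norm y * norm (t j)"
      by (rule Cauchy_Schwarz_ineq2)
    also have "\<dots> \<le> \<rho> * norm (t j)"
      using y by (intro mult_right_mono) auto
    finally have "x \<in> A j"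
      by (simp add: A_def)
    then have "1 \<le> S x"
      unfolding S_def using \<open>j \<in> J\<close> finJ
      by (intro order_trans[OF _ member_le_sum[of j]]) auto
    then show ?thesis
      by (auto simp: indicator_def)
  qed
  \<comment> \<open>The probability of landing in \<open>P\<close> from \<open>x\<close> after one
    step. Its mean under \<open>G\<close> is the measure of \<open>P\<close> under
    \<open>conv U G\<close>.\<close>
  define h :: "'a \<Rightarrow> real" where "h x = (\<integral>y. indicator P (x + y) \<partial>U)" for x
  have h_int_U: "integrable U (\<lambda>y. indicator P (x + y) :: real)" for x
    by (rule U.integrable_const_bound[where B = 1]) (auto simp: indicator_def)
  have h_bound: "\<bar>indicator P x - h x\<bar> \<le> S x" for x
  proof -
    have "indicator P x - h x = (\<integral>y. indicator P x - indicator P (x + y) \<partial>U)"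
      unfolding h_def using h_int_U[of x] by (simp add: U.prob_space)
    also have "\<bar>\<dots>\<bar> \<le> (\<integral>y. \<bar>indicator P x - indicator P (x + y)\<bar> \<partial>U)"
      by (rule integral_abs_bound)
    also have "\<dots> \<le> (\<integral>y. S x \<partial>U)"
    proof (rule integral_mono_AE)
      show "AE y in U. \<bar>indicator P x - indicator P (x + y)\<bar> \<le> S x"
        using AE_U by eventually_elim (use crossing in auto)
    qed (auto intro!: h_int_U Bochner_Integration.integrable_diff integrable_abs)
    finally show ?thesis by (simp add: U.prob_space)
  qed
  have [measurable]: "h \<in> borel_measurable borel"
    unfolding h_def by measurable
  have indP_int: "integrable G (indicator P :: 'a \<Rightarrow> real)"
    by (rule G.integrable_const_bound[where B = 1]) (auto simp: indicator_def)
  have h_int: "integrable G h"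
  proof (rule G.integrable_const_bound[where B = 1])
    have "0 \<le> h x" "h x \<le> 1" for x
      unfolding h_def
      by (auto intro!: Bochner_Integration.integral_nonneg U.integral_le_const h_int_U)
    then show "AE x in G. norm (h x) \<le> 1"
      by auto
  qed simp
  have "measure G P = (\<integral>x. indicator P x \<partial>G)"
    using borel_probD[OF G] by simp
  moreover have "measure (conv U G) P = (\<integral>x. h x \<partial>G)"
    unfolding h_def conv_commute[OF U G] by (rule measure_conv[OF G U P_borel])
  ultimately have "measure G P - measure (conv U G) P = (\<integral>x. indicator P x - h x \<partial>G)"
    using indP_int h_int by simp
  also have "\<bar>\<dots>\<bar> \<le> (\<integral>x. \<bar>indicator P x - h x\<bar> \<partial>G)"
    by (rule integral_abs_bound)
  also have "\<dots> \<le> (\<integral>x. S x \<partial>G)"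
    by (rule integral_mono) (use indP_int h_int S_int h_bound in auto)
  also have "\<dots> = (\<Sum>j\<in>J. measure G (A j))"
    unfolding S_def using borel_probD[OF G]
    by (subst Bochner_Integration.integral_sum)
       (auto intro!: G.integrable_const_bound[where B = 1] simp: indicator_def)
  finally show ?thesis
    by (simp add: A_def)
qed

subsection \<open>Successive convolution powers on polyhedra\<close>

text \<open>Countably many balls exhaust the space, so they cannot all be null.\<close>

lemma ball_not_null:
  fixes F :: "'a::real_normed_vector measure"
  assumes "borel_prob F"
  shows "\<exists>N::nat. \<not> (AE x in F. \<not> norm x \<le> real N)"
proof (rule ccontr)
  interpret F: prob_space F by (rule borel_probD[OF assms])
  assume "\<nexists>N::nat. \<not> (AE x in F. \<not> norm x \<le> real N)"
  then have "AE x in F. \<forall>N::nat. \<not> norm x \<le> real N"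
    by (simp add: AE_all_countable)
  then have "AE x in F. False"
    by eventually_elim (meson real_arch_simple)
  then show False by simp
qed

text \<open>If the inner product were constant on arbitrarily large balls, the constants would have
  to agree with the one on a ball of positive mass, which makes the whole marginal
  degenerate.\<close>

lemma nondegenerate_truncation:
  fixes F :: "'a::{real_inner, second_countable_topology} measure"
  assumes F: "borel_prob F" and nondeg: "nondegenerate (marginal F t)"
  shows "\<exists>N::nat. \<forall>n\<ge>N. \<not> (\<exists>a. AE x in F. norm x \<le> real n \<longrightarrow> inner x t = a)"
proof (rule ccontr)
  assume "\<not> ?thesis"
  then have ex: "\<exists>n\<ge>N. \<exists>a. AE x in F. norm x \<le> real n \<longrightarrow> inner x t = a" for N :: nat
    by blast
  \<comment> \<open>Constancy on a larger ball is inherited, so it holds for every radius and a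
    constant can be chosen for each.\<close>
  have "\<exists>a. AE x in F. norm x \<le> real N \<longrightarrow> inner x t = a" for N :: nat
  proof -
    obtain n c where "n \<ge> N" and ae: "AE x in F. norm x \<le> real n \<longrightarrow> inner x t = c"
      using ex[of N] by blast
    from ae have "AE x in F. norm x \<le> real N \<longrightarrow> inner x t = c"
      by eventually_elim (use \<open>n \<ge> N\<close> in auto)
    then show ?thesis by blast
  qed
  then obtain a where a: "\<And>N. AE x in F. norm x \<le> real N \<longrightarrow> inner x t = a N"
    by metis
  interpret F: prob_space F by (rule borel_probD[OF F])
  have all: "AE x in F. \<forall>N. norm x \<le> real N \<longrightarrow> inner x t = a N"
    using a by (simp add: AE_all_countable)
  obtain N0 where N0: "\<not> (AE x in F. \<not> norm x \<le> real N0)"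
    using ball_not_null[OF F] by blast
  have eq: "a N = a N0" if "N \<ge> N0" for N
  proof (rule ccontr)
    assume ne: "a N \<noteq> a N0"
    have "AE x in F. \<not> norm x \<le> real N0"
      using all
    proof eventually_elim
      case (elim x)
      then show ?case
        using ne that by (metis of_nat_mono order_trans)
    qed
    then show False using N0 by blast
  qed
  have "AE x in F. inner x t = a N0"
    using all
  proof eventually_elim
    case (elim x)
    obtain N :: nat where "norm x \<le> real N"
      using real_arch_simple by blast
    \<comment> \<open>The constants are known to agree only for radii from \<open>N0\<close>
      on.\<close>
    then have "norm x \<le> real (max N N0)" by simp
    then show ?case
      using elim eq[of "max N N0"] by simp
  qed
  then have "AE x in marginal F t. x = a N0"
    by (subst AE_marginal_iff[OF F]) auto
  then show False
    using nondeg by (auto simp: nondegenerate_def)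
qed

theorem theorem4:
  fixes M :: "'w measure"
    and \<xi> :: "'w \<Rightarrow> 'a::{real_inner, polish_space}"
    and F :: "'a measure"
    and m :: nat
    and t :: "nat \<Rightarrow> 'a"
  assumes "infinite_dimensional TYPE('a)"
    and "prob_space M"
    and "\<xi> \<in> borel_measurable M"
    and "F = distr M borel \<xi>"
    and "m \<ge> 1"
    and "\<And>j. j \<in> {1..m} \<Longrightarrow>
           nondegenerate (distr M borel (\<lambda>\<omega>. inner (\<xi> \<omega>) (t j))) \<or>
           distr M borel (\<lambda>\<omega>. inner (\<xi> \<omega>) (t j)) = return borel 0"
  shows "\<exists>c::real. c > 0 \<and> (\<forall>n\<ge>1. \<forall>P\<in>polyhedra m t.
           \<bar>measure (conv_power F n) P - measure (conv_power F (n + 1)) P\<bar> \<le> c * real n powr (- 1 / 2))"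
proof -
  have F: "borel_prob F"
    unfolding borel_prob_def assms(4) using prob_space.prob_space_distr[OF assms(2,3)] by simp
  have marginal_F: "marginal F s = distr M borel (\<lambda>\<omega>. inner (\<xi> \<omega>) s)" for s
    unfolding assms(4) by (subst distr_distr) (use assms(3) in \<open>auto simp: comp_def\<close>)
  \<comment> \<open>By assumption the marginals outside \<open>J\<close> are concentrated at 0, so a
    step almost surely does not cross the corresponding faces.\<close>
  define J where "J = {j \<in> {1..m}. nondegenerate (marginal F (t j))}"
  have J: "J \<subseteq> {1..m}" and finJ: "finite J"
    by (auto simp: J_def)
  have zero_F: "AE x in F. inner x (t j) = 0" if "j \<in> {1..m} - J" for j
  proof -
    have eq: "marginal F (t j) = return borel 0"
      using assms(6)[of j] that by (auto simp: J_def marginal_F)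
    have "AE x in marginal F (t j). x = 0"
      unfolding eq by (subst AE_return) auto
    then show ?thesis
      by (subst (asm) AE_marginal_iff[OF F]) auto
  qed
  have "\<exists>N::nat. \<forall>n\<ge>N. \<not> (\<exists>a. AE x in F. norm x \<le> real n \<longrightarrow> inner x (t j) = a)" if "j \<in> J" for j
    using nondegenerate_truncation[OF F, of "t j"] that by (simp add: J_def)
  then obtain N :: "nat \<Rightarrow> nat" where
    N: "\<And>j n a. j \<in> J \<Longrightarrow> n \<ge> N j \<Longrightarrow> \<not> (AE x in F. norm x \<le> real n \<longrightarrow> inner x (t j) = a)"
    by metis
  obtain N0 :: nat where N0: "\<not> (AE x in F. \<not> norm x \<le> real N0)"
    using ball_not_null[OF F] by blast
  \<comment> \<open>The sum dominates \<open>N0\<close> and every \<open>N j\<close>: the ball has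
    positive mass, and truncation to it keeps all marginals in \<open>J\<close> non-degenerate. The
    successor makes the radius positive, as the concentration lemma requires.\<close>
  define r where "r = Suc (N0 + (\<Sum>j\<in>J. N j))"
  have r_ge: "r \<ge> N j" if "j \<in> J" for j
    using member_le_sum[of j J N] that finJ by (simp add: r_def)
  define B where "B = {x::'a. norm x \<le> real r}"
  have B: "B \<in> sets borel"
    unfolding B_def by simp
  interpret F: prob_space F by (rule borel_probD[OF F])
  have "measure F B > 0"
  proof (rule ccontr)
    assume "\<not> measure F B > 0"
    then have "emeasure F B = 0"
      using measure_nonneg[of F B] by (simp add: F.emeasure_eq_measure)
    then have "AE x in F. x \<notin> B"
      using B borel_probD[OF F] by (subst AE_iff_measurable[of B]) auto
    moreover have "real N0 \<le> real r"
      unfolding r_def by (intro of_nat_mono) simp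
    ultimately have "AE x in F. \<not> norm x \<le> real N0"
      by (auto simp: B_def elim!: eventually_mono)
    then show False using N0 by blast
  qed
  then obtain U V p where
    U: "borel_prob U" and V: "borel_prob V" and p: "0 < p" "p < 1" and mix: "mixture p U V F"
    and AE_U: "\<And>Q. (AE x in U. Q x) \<longleftrightarrow> (AE x in F. x \<in> B \<longrightarrow> Q x)"
    by (rule mixture_conditioned[OF F B]) (rule that)
  have bdd: "AE x in U. norm x \<le> real r"
    unfolding AE_U by (simp add: B_def)
  have zero: "AE y in U. inner y (t j) = 0" if "j \<in> {1..m} - J" for j
    unfolding AE_U using zero_F[OF that] by eventually_elim simp
  have "\<exists>C>0. \<forall>n W b. borel_prob W \<longrightarrow>
      measure (conv (conv_power U n) W) {x. \<bar>inner x (t j) - b\<bar> \<le> real r * norm (t j)} \<le> C / sqrt (real n + 1)"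
    if "j \<in> J" for j
  proof (rule concentration_conv_power[OF U bdd])
    show "\<not> (AE x in U. inner x (t j) = a)" for a
      unfolding AE_U using N[OF that r_ge[OF that], of a] by (simp add: B_def)
  qed (simp add: r_def del: of_nat_Suc)
  then obtain C where C_pos: "\<And>j. j \<in> J \<Longrightarrow> C j > 0"
    and C: "\<And>j n W b. j \<in> J \<Longrightarrow> borel_prob W \<Longrightarrow>
      measure (conv (conv_power U n) W) {x. \<bar>inner x (t j) - b\<bar> \<le> real r * norm (t j)} \<le> C j / sqrt (real n + 1)"
    by metis
  \<comment> \<open>The constants \<open>C j\<close> hold for all centres and all \<open>W\<close>,
    so \<open>K\<close> is independent of the polyhedron and of the number of factors.\<close>
  define K where "K = (\<Sum>j\<in>J. C j)"
  have K: "K \<ge> 0"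
    unfolding K_def using C_pos by (intro sum_nonneg) (simp add: less_imp_le)
  have bound: "\<bar>measure (conv_power F n) P - measure (conv_power F (n + 1)) P\<bar> \<le> (K + 1) / (1 - p) * real n powr (- 1 / 2)"
    if n: "n \<ge> 1" and "P \<in> polyhedra m t" for n P
  proof -
    obtain b where P: "P = {x. \<forall>j\<in>{1..m}. ereal (inner x (t j)) \<le> b j}"
      using \<open>P \<in> polyhedra m t\<close> by (auto simp: polyhedra_def)
    have P_borel: "P \<in> sets borel"
      unfolding P by (rule polyhedron_borel) simp
    have step: "\<bar>measure (conv (conv_power U k) W) P - measure (conv (conv_power U (Suc k)) W) P\<bar> \<le> K / sqrt (real k + 1)"
      if W: "borel_prob W" for k W
    proof -
      have "\<bar>measure (conv (conv_power U k) W) P - measure (conv U (conv (conv_power U k) W)) P\<bar> \<le>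
          (\<Sum>j\<in>J. measure (conv (conv_power U k) W) {x. \<bar>inner x (t j) - real_of_ereal (b j)\<bar> \<le> real r * norm (t j)})"
        by (rule measure_conv_polyhedron_le[OF U _ _ J bdd zero P])
           (auto intro: borel_prob_conv borel_prob_conv_power U W)
      also have "\<dots> \<le> (\<Sum>j\<in>J. C j / sqrt (real k + 1))"
        by (intro sum_mono C W)
      finally show ?thesis
        by (simp add: K_def sum_divide_distrib conv_assoc U W borel_prob_conv_power)
    qed
    have "\<bar>measure (conv_power F n) P - measure (conv_power F (Suc n)) P\<bar> \<le> (K + 1) / ((1 - p) * sqrt (real n + 1))"
      by (rule measure_conv_power_diff_le[OF U V F mix _ _ K P_borel step]) (use p in auto)
    \<comment> \<open>Replacing \<open>n + 1\<close> by \<open>n\<close> weakens the bound;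
      \<open>n \<ge> 1\<close> keeps the denominator positive.\<close>
    also have "\<dots> \<le> (K + 1) / ((1 - p) * sqrt (real n))"
      using p n K by (intro divide_left_mono mult_left_mono mult_pos_pos) auto
    also have "\<dots> = (K + 1) / (1 - p) * real n powr (- 1 / 2)"
      using n by (simp add: powr_minus_divide powr_half_sqrt)
    finally show ?thesis by simp
  qed
  show ?thesis
  proof (intro exI[of _ "(K + 1) / (1 - p)"] conjI allI impI ballI)
    show "(K + 1) / (1 - p) > 0"
      using K p by simp
  qed (rule bound)
qed

end
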